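(* Let $M$ be a smooth manifold of dimension $n\ge3$ and let $F=\alpha\phi(s)$, $s=\beta/\alpha$, be an $(\alpha,\beta)$-metric on $M$ with $\beta$ nowhere zero. The following assertions are equivalent (identities in $s$ being understood for all values of $s$ attained on $\mathcal D^*$): (a) $\rho_1=0$; (b) $\rho_2=0$; (c) $F$ is Riemannian (i.e. $g_{ij}$ does not depend on $y$); (d) $\phi(s)=\sqrt{k_1s^2+k_2}$ for some constants $k_1,k_2$.
   Context: $(\alpha,\beta)$-metrics. $M$ is an $n$-dimensional smooth manifold with induced local coordinates $(x^i,y^i)$ on $TM$; $\alpha=\sqrt{a_{ij}(x)y^iy^j}$ is the norm of a Riemannian metric, $\beta=b_i(x)y^i$ a 1-form. $(a^{ij})$ is the inverse of $(a_{ij})$, $b^i:=a^{ij}b_j$, $b^2:=b^ib_i$ (a function of $x$). Let $b_0>0$, let $J=(-b_0,b_0)$ or $J=(0,b_0)$, let $\phi:J\to\mathbb R$ be smooth, and assume $b(x)\le b_0$ for all $x$. $F:=\alpha\,\phi(s)$ with $s:=\beta/\alpha$, defined on the open set $\mathcal D$ of nonzero tangent vectors with $s\in J$. It is assumed that $\phi(t)>0$ and $\phi(t)-t\phi'(t)+(x^2-t^2)\phi''(t)>0$ for $t\in J$, $|t|<x<b_0$, and that $g_{ij}:=\frac12\frac{\partial^2F^2}{\partial y^i\partial y^j}$ is nondegenerate on $\mathcal D$, i.e. $\phi-s\phi'\ne0$ and $\phi-s\phi'+(b^2-s^2)\phi''\neq 0$ there. Primes denote derivatives in $s$. Put $\alpha_i:=\partial\alpha/\partial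 y^i$, $m_i:=b_i-s\alpha_i$, and let $\mathcal D^*\subset\mathcal D$ be the set of points where $m_i\ne 0$. Put $$\rho_1:=\phi\phi'-s(\phi'^2+\phi\phi''),\qquad \rho_2:=s^2(\phi'^2+\phi\phi'')-s\phi\phi'.$$ *)

theory Defs
  imports "HOL-Analysis.Analysis"
begin

section \<open>Smooth manifolds\<close>

text \<open>The next two definitions are meant for open \<open>S\<close> only: all derivatives are taken in the
  full space.\<close>

primrec Ck_on :: "nat \<Rightarrow> 'a::real_normed_vector set \<Rightarrow> ('a \<Rightarrow> 'b::real_normed_vector) \<Rightarrow> bool" where
  "Ck_on 0 S f \<longleftrightarrow> continuous_on S f"
| "Ck_on (Suc k) S f \<longleftrightarrow>
     (\<forall>x\<in>S. f differentiable (at x)) \<and> (\<forall>v. Ck_on k S (\<lambda>x. frechet_derivative f (at x) v))"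

definition smooth_on :: "'a::real_normed_vector set \<Rightarrow> ('a \<Rightarrow> 'b::real_normed_vector) \<Rightarrow> bool" where
  "smooth_on S f \<longleftrightarrow> (\<forall>k. Ck_on k S f)"

text \<open>A chart is a pair of its domain in the manifold and its coordinate map, whose values outside
  the domain are irrelevant.\<close>

type_synonym ('m, 'n) chart = "'m set \<times> ('m \<Rightarrow> real^'n)"

definition chart_image :: "('m, 'n) chart \<Rightarrow> (real^'n) set" where
  "chart_image c = snd c ` fst c"

definition chart_overlap :: "('m, 'n) chart \<Rightarrow> ('m, 'n) chart \<Rightarrow> (real^'n) set" where
  "chart_overlap c d = snd c ` (fst c \<inter> fst d)"

definition coord_change :: "('m, 'n) chart \<Rightarrow> ('m, 'n) chart \<Rightarrow> real^'n \<Rightarrow> real^'n" where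
  "coord_change c d = (\<lambda>x. snd d (inv_into (fst c) (snd c) x))"

text \<open>The atlas is not required to be maximal.\<close>

definition smooth_manifold :: "'m topology \<Rightarrow> ('m, 'n::finite) chart set \<Rightarrow> bool" where
  "smooth_manifold M \<A> \<longleftrightarrow>
     Hausdorff_space M \<and> second_countable M \<and>
     (\<forall>c\<in>\<A>. openin M (fst c) \<and> open (chart_image c) \<and>
        homeomorphic_map (subtopology M (fst c)) (top_of_set (chart_image c)) (snd c)) \<and>
     (\<Union>c\<in>\<A>. fst c) = topspace M \<and>
     (\<forall>c\<in>\<A>. \<forall>d\<in>\<A>. smooth_on (chart_overlap c d) (coord_change c d))"

text \<open>Tensor fields are families of component functions, one for each chart, related by the
  covariant transformation law.  At a point with coordinates \<open>x\<close> in the chart \<open>c\<close>, the matrix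
  \<open>a c x\<close> is \<open>(a\<^sub>i\<^sub>j)\<close> and the vector \<open>b c x\<close> is \<open>(b\<^sub>i)\<close>.\<close>

definition riemannian_metric ::
  "('m, 'n::finite) chart set \<Rightarrow> (('m, 'n) chart \<Rightarrow> real^'n \<Rightarrow> real^'n^'n) \<Rightarrow> bool" where
  "riemannian_metric \<A> a \<longleftrightarrow>
     (\<forall>c\<in>\<A>. smooth_on (chart_image c) (a c) \<and>
        (\<forall>x\<in>chart_image c. transpose (a c x) = a c x \<and> (\<forall>y. y \<noteq> 0 \<longrightarrow> y \<bullet> (a c x *v y) > 0))) \<and>
     (\<forall>c\<in>\<A>. \<forall>d\<in>\<A>. \<forall>x\<in>chart_overlap c d.
        a c x = transpose (jacobian (coord_change c d) (at x)) ** a d (coord_change c d x)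
                  ** jacobian (coord_change c d) (at x))"

definition one_form ::
  "('m, 'n::finite) chart set \<Rightarrow> (('m, 'n) chart \<Rightarrow> real^'n \<Rightarrow> real^'n) \<Rightarrow> bool" where
  "one_form \<A> b \<longleftrightarrow>
     (\<forall>c\<in>\<A>. smooth_on (chart_image c) (b c)) \<and>
     (\<forall>c\<in>\<A>. \<forall>d\<in>\<A>. \<forall>x\<in>chart_overlap c d.
        b c x = transpose (jacobian (coord_change c d) (at x)) *v b d (coord_change c d x))"

definition nowhere_zero ::
  "('m, 'n::finite) chart set \<Rightarrow> (('m, 'n) chart \<Rightarrow> real^'n \<Rightarrow> real^'n) \<Rightarrow> bool" where
  "nowhere_zero \<A> b \<longleftrightarrow> (\<forall>c\<in>\<A>. \<forall>x\<in>chart_image c. b c x \<noteq> 0)"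

section \<open>Pointwise data on a tangent space\<close>

text \<open>Here \<open>A\<close>, \<open>b\<close> stand for \<open>(a\<^sub>i\<^sub>j(x))\<close>, \<open>(b\<^sub>i(x))\<close> at a fixed point, and \<open>y\<close> for the induced
  fibre coordinates of a tangent vector at that point.\<close>

definition ab_alpha :: "real^'n^'n \<Rightarrow> real^'n \<Rightarrow> real" where
  "ab_alpha A y = sqrt (\<Sum>i\<in>UNIV. \<Sum>j\<in>UNIV. A $ i $ j * y $ i * y $ j)"

definition ab_beta :: "real^'n \<Rightarrow> real^'n \<Rightarrow> real" where
  "ab_beta b y = (\<Sum>i\<in>UNIV. b $ i * y $ i)"

definition ab_s :: "real^'n^'n \<Rightarrow> real^'n \<Rightarrow> real^'n \<Rightarrow> real" where
  "ab_s A b y = ab_beta b y / ab_alpha A y"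

definition ab_norm_sq :: "real^'n^'n \<Rightarrow> real^'n \<Rightarrow> real" where
  "ab_norm_sq A b = (\<Sum>i\<in>UNIV. (\<Sum>j\<in>UNIV. matrix_inv A $ i $ j * b $ j) * b $ i)"

definition ab_F :: "(real \<Rightarrow> real) \<Rightarrow> real^'n^'n \<Rightarrow> real^'n \<Rightarrow> real^'n \<Rightarrow> real" where
  "ab_F \<phi> A b y = ab_alpha A y * \<phi> (ab_s A b y)"

definition ab_D :: "real set \<Rightarrow> real^'n^'n \<Rightarrow> real^'n \<Rightarrow> (real^'n) set" where
  "ab_D J A b = {y. y \<noteq> 0 \<and> ab_s A b y \<in> J}"

definition partial :: "'n \<Rightarrow> (real^'n \<Rightarrow> real) \<Rightarrow> real^'n \<Rightarrow> real" where
  "partial i f y = deriv (\<lambda>t. f (y + t *\<^sub>R axis i 1)) 0"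

definition fundamental_tensor :: "(real^'n \<Rightarrow> real) \<Rightarrow> real^'n \<Rightarrow> real^'n^'n" where
  "fundamental_tensor F y = (\<chi> i j. 1/2 * partial i (partial j (\<lambda>z. (F z)\<^sup>2)) y)"

definition ab_m :: "real^'n^'n \<Rightarrow> real^'n \<Rightarrow> real^'n \<Rightarrow> real^'n" where
  "ab_m A b y = (\<chi> i. b $ i - ab_s A b y * partial i (ab_alpha A) y)"

definition ab_Dstar :: "real set \<Rightarrow> real^'n^'n \<Rightarrow> real^'n \<Rightarrow> (real^'n) set" where
  "ab_Dstar J A b = {y \<in> ab_D J A b. ab_m A b y \<noteq> 0}"

section \<open>(alpha,beta)-metrics\<close>

definition alpha_beta_metric ::
  "('m, 'n::finite) chart set \<Rightarrow> (('m, 'n) chart \<Rightarrow> real^'n \<Rightarrow> real^'n^'n) \<Rightarrow>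
   (('m, 'n) chart \<Rightarrow> real^'n \<Rightarrow> real^'n) \<Rightarrow> (real \<Rightarrow> real) \<Rightarrow> real \<Rightarrow> real set \<Rightarrow> bool" where
  "alpha_beta_metric \<A> a b \<phi> b0 J \<longleftrightarrow>
     riemannian_metric \<A> a \<and> one_form \<A> b \<and>
     b0 > 0 \<and> (J = {-b0<..<b0} \<or> J = {0<..<b0}) \<and> smooth_on J \<phi> \<and>
     (\<forall>c\<in>\<A>. \<forall>x\<in>chart_image c. sqrt (ab_norm_sq (a c x) (b c x)) \<le> b0) \<and>
     (\<forall>t\<in>J. \<phi> t > 0) \<and>
     (\<forall>t\<in>J. \<forall>x. \<bar>t\<bar> < x \<and> x < b0 \<longrightarrow>
        \<phi> t - t * deriv \<phi> t + (x\<^sup>2 - t\<^sup>2) * deriv (deriv \<phi>) t > 0) \<and>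
     (\<forall>c\<in>\<A>. \<forall>x\<in>chart_image c. \<forall>y\<in>ab_D J (a c x) (b c x).
        invertible (fundamental_tensor (ab_F \<phi> (a c x) (b c x)) y))"

definition s_values ::
  "('m, 'n::finite) chart set \<Rightarrow> (('m, 'n) chart \<Rightarrow> real^'n \<Rightarrow> real^'n^'n) \<Rightarrow>
   (('m, 'n) chart \<Rightarrow> real^'n \<Rightarrow> real^'n) \<Rightarrow> real set \<Rightarrow> real set" where
  "s_values \<A> a b J =
     (\<Union>c\<in>\<A>. \<Union>x\<in>chart_image c. ab_s (a c x) (b c x) ` ab_Dstar J (a c x) (b c x))"

definition F_is_riemannian ::
  "('m, 'n::finite) chart set \<Rightarrow> (('m, 'n) chart \<Rightarrow> real^'n \<Rightarrow> real^'n^'n) \<Rightarrow>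
   (('m, 'n) chart \<Rightarrow> real^'n \<Rightarrow> real^'n) \<Rightarrow> (real \<Rightarrow> real) \<Rightarrow> real set \<Rightarrow> bool" where
  "F_is_riemannian \<A> a b \<phi> J \<longleftrightarrow>
     (\<forall>c\<in>\<A>. \<forall>x\<in>chart_image c.
        fundamental_tensor (ab_F \<phi> (a c x) (b c x)) constant_on ab_D J (a c x) (b c x))"

definition rho1 :: "(real \<Rightarrow> real) \<Rightarrow> real \<Rightarrow> real" where
  "rho1 \<phi> s = \<phi> s * deriv \<phi> s - s * ((deriv \<phi> s)\<^sup>2 + \<phi> s * deriv (deriv \<phi>) s)"

definition rho2 :: "(real \<Rightarrow> real) \<Rightarrow> real \<Rightarrow> real" where
  "rho2 \<phi> s = s\<^sup>2 * ((deriv \<phi> s)\<^sup>2 + \<phi> s * deriv (deriv \<phi>) s) - s * \<phi> s * deriv \<phi> s"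

end

theory Submission
  imports Defs
begin

text \<open>Put \<open>\<psi> = \<phi>\<^sup>2\<close>, so that \<open>F\<^sup>2 = \<alpha>\<^sup>2 \<psi>(s)\<close> and \<open>2 \<rho>\<^sub>1 = \<psi>' - s \<psi>''\<close>.
  The values of \<open>s\<close> attained at a point are those in \<open>J\<close> with \<open>s\<^sup>2 < b\<^sup>2\<close>; over the whole manifold
  they form an open interval. There \<open>\<rho>\<^sub>1 = 0\<close> means that \<open>\<psi>\<close> is \<open>k\<^sub>1 s\<^sup>2 + k\<^sub>2\<close>, and then
  \<open>F\<^sup>2 = k\<^sub>1 \<beta>\<^sup>2 + k\<^sub>2 \<alpha>\<^sup>2\<close> is a quadratic form. Conversely, if \<open>g\<close> is constant in \<open>y\<close>, then
  \<open>F\<^sup>2 = g(y, y)\<close> by Euler's theorem. With \<open>e\<close> the dual vector of \<open>\<beta>\<close> and \<open>w\<close> in the kernel of \<open>\<beta>\<close>,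
  averaging this over \<open>y = p e \<plusminus> q w\<close>, where \<open>\<alpha>\<close> and \<open>s\<close> agree for both signs, shows that \<open>\<psi>\<close> is
  \<open>k\<^sub>1 s\<^sup>2 + k\<^sub>2\<close> at each point. Applying \<open>\<rho>\<^sub>1\<close> makes it unnecessary to compare the
  constants at different points.\<close>

section \<open>One real variable\<close>

text \<open>\<open>Ck_on\<close> takes derivatives in the full space, so equality on
  \<open>S\<close> passes to the derivatives because \<open>S\<close> is open.\<close>

lemma Ck_on_cong:
  assumes "open S" "Ck_on k S f" "\<And>x. x \<in> S \<Longrightarrow> f x = g x"
  shows "Ck_on k S g"
  using assms(2,3)
proof (induction k arbitrary: f g)
  case 0
  then show ?case by (auto cong: continuous_on_cong)
next
  case (Suc k)
  have D: "(g has_derivative frechet_derivative f (at x)) (at x)" if "x \<in> S" for x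
  proof (rule has_derivative_transform_within_open[OF _ assms(1) that])
    show "(f has_derivative frechet_derivative f (at x)) (at x)"
      using Suc.prems(1) that frechet_derivative_works by auto
  qed (use Suc.prems(2) in auto)
  have "Ck_on k S (\<lambda>x. frechet_derivative g (at x) v)" for v
    by (rule Suc.IH[of "\<lambda>x. frechet_derivative f (at x) v"])
      (use Suc.prems(1) frechet_derivative_at[OF D] in simp_all)
  then show ?case
    using D by (auto simp: differentiable_def)
qed

text \<open>Translates directional Frechet derivatives into \<open>deriv\<close>: on the real line
  the direction 1 determines them. Iteration supplies the successive derivatives of
  \<open>\<phi>\<close>.\<close>

lemma Ck_on_Suc_deriv:
  fixes f :: "real \<Rightarrow> real"
  assumes "open S" "Ck_on (Suc k) S f"
  shows "Ck_on k S (deriv f)" and "x \<in> S \<Longrightarrow> (f has_field_derivative deriv f x) (at x)"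
proof -
  have D: "(f has_field_derivative deriv f x) (at x)" if "x \<in> S" for x
    using assms(2) that by (simp add: DERIV_deriv_iff_real_differentiable)
  then show "x \<in> S \<Longrightarrow> (f has_field_derivative deriv f x) (at x)" .
  have "frechet_derivative f (at x) 1 = deriv f x" if "x \<in> S" for x
    using fun_cong[OF frechet_derivative_at[OF D[OF that, unfolded has_field_derivative_def]], of 1]
    by simp
  then show "Ck_on k S (deriv f)"
    by (intro Ck_on_cong[OF assms(1) Ck_on.simps(2)[THEN iffD1, OF assms(2), THEN conjunct2, THEN spec, of 1]])
qed

lemma rho2_eq_rho1: "rho2 \<phi> s = - s * rho1 \<phi> s"
  by (simp add: rho1_def rho2_def power2_eq_square algebra_simps)

text \<open>Differentiating \<open>\<psi>1 s = s * \<psi>2 s\<close> gives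
  \<open>s * \<psi>3 s = 0\<close>, which is why a third derivative is assumed. So
  \<open>\<psi>2\<close> is a constant \<open>c\<close>, and
  \<open>\<psi> s - c/2 * s\<^sup>2\<close> has derivative \<open>s * c - c * s = 0\<close>.\<close>

lemma quadratic_if_ode:
  fixes \<psi> :: "real \<Rightarrow> real"
  assumes S: "open S" "connected S"
    and D: "\<And>s. s \<in> S \<Longrightarrow> (\<psi> has_field_derivative \<psi>1 s) (at s)"
      "\<And>s. s \<in> S \<Longrightarrow> (\<psi>1 has_field_derivative \<psi>2 s) (at s)"
      "\<And>s. s \<in> S \<Longrightarrow> (\<psi>2 has_field_derivative \<psi>3 s) (at s)"
    and ode: "\<And>s. s \<in> S \<Longrightarrow> \<psi>1 s = s * \<psi>2 s"
  shows "\<exists>k1 k2. \<forall>s\<in>S. \<psi> s = k1 * s\<^sup>2 + k2"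
proof -
  have 0: "\<psi>3 s = 0" if "s \<in> S" "s \<noteq> 0" for s
  proof -
    have "((\<lambda>s. s * \<psi>2 s) has_field_derivative \<psi>2 s) (at s)"
      using has_field_derivative_transform_within_open[OF D(2)[OF that(1)] S(1) that(1)] ode by simp
    moreover have "((\<lambda>s. s * \<psi>2 s) has_field_derivative \<psi>2 s + s * \<psi>3 s) (at s)"
      using D(3)[OF that(1)] by (auto intro!: derivative_eq_intros)
    ultimately have "\<psi>2 s = \<psi>2 s + s * \<psi>3 s"
      by (rule DERIV_unique)
    then show ?thesis
      using that(2) by simp
  qed
  have "continuous_on S \<psi>2"
    by (rule continuous_at_imp_continuous_on) (auto intro: DERIV_isCont[OF D(3)])
  moreover have "\<forall>s\<in>S - {0}. (\<psi>2 has_field_derivative 0) (at s)"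
    using D(3) 0 by (metis DiffE insertI1)
  \<comment> \<open>At 0 the equation \<open>s * \<psi>3 s = 0\<close> carries no information; 0 is
    made the finite exceptional set, which continuity of \<open>\<psi>2\<close> bridges.\<close>
  ultimately have "\<psi>2 constant_on S"
    using DERIV_zero_connected_constant_on[OF S(2,1), of "{0}" \<psi>2] by simp
  then obtain c where c: "\<And>s. s \<in> S \<Longrightarrow> \<psi>2 s = c"
    unfolding constant_on_def by blast
  have "((\<lambda>s. \<psi> s - c/2 * s\<^sup>2) has_field_derivative 0) (at s)" if "s \<in> S" for s
    using D(1)[OF that] ode[OF that] c[OF that] by (auto intro!: derivative_eq_intros)
  then have "(\<lambda>s. \<psi> s - c/2 * s\<^sup>2) constant_on S"
    using has_field_derivative_0_imp_constant_on S by blast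
  then obtain k where "\<And>s. s \<in> S \<Longrightarrow> \<psi> s - c/2 * s\<^sup>2 = k"
    unfolding constant_on_def by blast
  then have "\<forall>s\<in>S. \<psi> s = c/2 * s\<^sup>2 + k"
    by (simp add: diff_eq_eq add.commute)
  then show ?thesis by blast
qed

text \<open>Differentiating the square once and twice gives \<open>\<phi> \<phi>' = k1 s\<close> and
  \<open>\<phi>'\<^sup>2 + \<phi> \<phi>'' = k1\<close>. Any open set around \<open>s\<close> will
  do for \<open>S\<close>, in particular the values attained at a single point of the
  manifold.\<close>

lemma rho1_0_if_quadratic:
  assumes S: "open S" "s \<in> S" and q: "\<And>s. s \<in> S \<Longrightarrow> (\<phi> s)\<^sup>2 = k1 * s\<^sup>2 + k2"
    and D: "\<And>s. s \<in> S \<Longrightarrow> (\<phi> has_field_derivative deriv \<phi> s) (at s)"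
      "\<And>s. s \<in> S \<Longrightarrow> (deriv \<phi> has_field_derivative deriv (deriv \<phi>) s) (at s)"
  shows "rho1 \<phi> s = 0"
proof -
  have 1: "\<phi> s * deriv \<phi> s = k1 * s" if "s \<in> S" for s
  proof -
    have "((\<lambda>s. (\<phi> s)\<^sup>2) has_field_derivative 2 * k1 * s) (at s)"
      by (rule has_field_derivative_transform_within_open[of "\<lambda>s. k1 * s\<^sup>2 + k2", OF _ S(1) that])
        (auto simp: q intro!: derivative_eq_intros)
    moreover have "((\<lambda>s. (\<phi> s)\<^sup>2) has_field_derivative 2 * (\<phi> s * deriv \<phi> s)) (at s)"
      by (auto intro!: derivative_eq_intros D(1) that)
    ultimately have "2 * k1 * s = 2 * (\<phi> s * deriv \<phi> s)"
      by (rule DERIV_unique)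
    then show ?thesis by simp
  qed
  have "((\<lambda>s. \<phi> s * deriv \<phi> s) has_field_derivative k1) (at s)"
    by (rule has_field_derivative_transform_within_open[of "\<lambda>s. k1 * s", OF _ S])
      (auto simp: 1 intro!: derivative_eq_intros)
  moreover have "((\<lambda>s. \<phi> s * deriv \<phi> s) has_field_derivative
      (deriv \<phi> s)\<^sup>2 + \<phi> s * deriv (deriv \<phi>) s) (at s)"
    using D(1)[OF S(2)] D(2)[OF S(2)]
    by (auto intro!: derivative_eq_intros simp: power2_eq_square)
  ultimately have "k1 = (deriv \<phi> s)\<^sup>2 + \<phi> s * deriv (deriv \<phi>) s"
    by (rule DERIV_unique)
  then show ?thesis
    by (simp add: rho1_def 1[OF S(2)])
qed

text \<open>By \<open>rho2_eq_rho1\<close>, \<open>rho1\<close> vanishes on \<open>S\<close> away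
  from 0, and continuity carries this to 0. Taking the limit along \<open>at s\<close> treats all
  \<open>s\<close> alike.\<close>

lemma rho1_0_if_rho2_0:
  assumes S: "open S" "s \<in> S" and 0: "\<And>s. s \<in> S \<Longrightarrow> rho2 \<phi> s = 0"
    and cont: "isCont \<phi> s" "isCont (deriv \<phi>) s" "isCont (deriv (deriv \<phi>)) s"
  shows "rho1 \<phi> s = 0"
proof -
  have "isCont (rho1 \<phi>) s"
    unfolding rho1_def[abs_def] by (intro continuous_intros cont)
  then have "(rho1 \<phi> \<longlongrightarrow> rho1 \<phi> s) (at s)"
    by (simp add: isCont_def)
  moreover have "\<forall>\<^sub>F t in at s. t \<in> S"
    using S by (rule eventually_at_in_open')
  then have "\<forall>\<^sub>F t in at s. rho1 \<phi> t = 0"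
    using eventually_neq_at_within[of 0]
    by eventually_elim (use 0 in \<open>auto simp: rho2_eq_rho1\<close>)
  then have "(rho1 \<phi> \<longlongrightarrow> 0) (at s)"
    by (rule tendsto_eventually)
  ultimately show ?thesis
    using tendsto_unique trivial_limit_at by blast
qed

lemma quadratic_if_rho1_0:
  assumes "open S" "connected S"
    and D: "\<And>s. s \<in> S \<Longrightarrow> (\<phi> has_field_derivative deriv \<phi> s) (at s)"
      "\<And>s. s \<in> S \<Longrightarrow> (deriv \<phi> has_field_derivative deriv (deriv \<phi>) s) (at s)"
      "\<And>s. s \<in> S \<Longrightarrow> (deriv (deriv \<phi>) has_field_derivative \<phi>3 s) (at s)"
    and 0: "\<And>s. s \<in> S \<Longrightarrow> rho1 \<phi> s = 0"
  shows "\<exists>k1 k2. \<forall>s\<in>S. (\<phi> s)\<^sup>2 = k1 * s\<^sup>2 + k2"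
proof (rule quadratic_if_ode[OF assms(1,2), of "\<lambda>s. (\<phi> s)\<^sup>2" "\<lambda>s. 2 * (\<phi> s * deriv \<phi> s)"
      "\<lambda>s. 2 * ((deriv \<phi> s)\<^sup>2 + \<phi> s * deriv (deriv \<phi>) s)"
      "\<lambda>s. 2 * (3 * deriv \<phi> s * deriv (deriv \<phi>) s + \<phi> s * \<phi>3 s)"])
  fix s assume s: "s \<in> S"
  show "((\<lambda>s. (\<phi> s)\<^sup>2) has_field_derivative 2 * (\<phi> s * deriv \<phi> s)) (at s)"
    using D(1)[OF s] by (auto intro!: derivative_eq_intros)
  show "((\<lambda>s. 2 * (\<phi> s * deriv \<phi> s)) has_field_derivative
      2 * ((deriv \<phi> s)\<^sup>2 + \<phi> s * deriv (deriv \<phi>) s)) (at s)"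
    using D(1,2)[OF s] by (auto intro!: derivative_eq_intros simp: power2_eq_square)
  show "((\<lambda>s. 2 * ((deriv \<phi> s)\<^sup>2 + \<phi> s * deriv (deriv \<phi>) s)) has_field_derivative
      2 * (3 * deriv \<phi> s * deriv (deriv \<phi>) s + \<phi> s * \<phi>3 s)) (at s)"
    by (rule DERIV_cong[OF DERIV_cmult[OF DERIV_add[OF DERIV_power[OF D(2)[OF s]]
            DERIV_mult[OF D(1)[OF s] D(3)[OF s]]]]])
      (simp add: algebra_simps)
  show "2 * (\<phi> s * deriv \<phi> s) = s * (2 * ((deriv \<phi> s)\<^sup>2 + \<phi> s * deriv (deriv \<phi>) s))"
    using 0[OF s] by (simp add: rho1_def)
qed

section \<open>Partial derivatives\<close>

lemma partial_eq:
  assumes "(f has_derivative D) (at y)"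
  shows "partial i f y = D (axis i 1)"
proof -
  have "((\<lambda>t. y + t *\<^sub>R axis i 1) has_derivative (\<lambda>t. 0 + t *\<^sub>R axis i 1)) (at (0::real))"
    by (intro has_derivative_add has_derivative_const has_derivative_scaleR_left has_derivative_ident)
  then have "((\<lambda>t. f (y + t *\<^sub>R axis i 1)) has_derivative (\<lambda>t. D (t *\<^sub>R axis i 1))) (at 0)"
    using has_derivative_compose[of "\<lambda>t. y + t *\<^sub>R axis i 1" _ 0 UNIV f D] assms by simp
  moreover have "(\<lambda>t. D (t *\<^sub>R axis i 1)) = (*) (D (axis i 1))"
    using has_derivative_bounded_linear[OF assms] by (auto simp: linear_simps)
  ultimately show ?thesis
    unfolding partial_def by (simp add: DERIV_imp_deriv has_field_derivative_def)
qed

text \<open>The gradient \<open>G\<close> has to be known near \<open>y\<close>, since the outer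
  partial derivative moves the point at which the inner one is taken.\<close>

lemma second_partial_eq:
  assumes "open S" "y \<in> S"
    and G: "\<And>z. z \<in> S \<Longrightarrow> (f has_derivative (\<lambda>h. h \<bullet> G z)) (at z)"
    and H: "(G has_derivative H) (at y)"
  shows "partial i (partial j f) y = H (axis i 1) $ j"
proof -
  have "((\<lambda>z. G z $ j) has_derivative (\<lambda>h. H h $ j)) (at y)"
    using H by (rule bounded_linear.has_derivative[OF bounded_linear_vec_nth])
  then have "(partial j f has_derivative (\<lambda>h. H h $ j)) (at y)"
    by (rule has_derivative_transform_within_open[OF _ assms(1,2)])
      (simp add: partial_eq[OF G] inner_axis inner_commute)
  then show ?thesis by (rule partial_eq)
qed

text \<open>Entry \<open>(i, j)\<close> differentiates component \<open>j\<close> of the gradient in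
  direction \<open>i\<close>, whereas \<open>matrix H\<close> has the direction as column index;
  hence the transpose.\<close>

lemma fundamental_tensor_eq:
  assumes "open S" "y \<in> S"
    and "\<And>z. z \<in> S \<Longrightarrow> ((\<lambda>z. (F z)\<^sup>2) has_derivative (\<lambda>h. h \<bullet> G z)) (at z)"
    and "(G has_derivative H) (at y)"
  shows "fundamental_tensor F y = (1/2) *\<^sub>R transpose (matrix H)"
  by (simp add: fundamental_tensor_def second_partial_eq[OF assms] transpose_def matrix_def vec_eq_iff)

section \<open>Pointwise computations\<close>

lemma ab_beta_eq: "ab_beta b y = b \<bullet> y"
  by (simp add: ab_beta_def inner_vec_def)

lemma ab_alpha_eq: "ab_alpha A y = sqrt (y \<bullet> (A *v y))"
  unfolding ab_alpha_def inner_vec_def matrix_vector_mult_def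
  by (simp add: sum_distrib_left mult_ac)

lemma ab_norm_sq_eq: "ab_norm_sq A b = (matrix_inv A *v b) \<bullet> b"
  by (simp add: ab_norm_sq_def inner_vec_def matrix_vector_mult_def)

text \<open>The data at one point of the manifold in one chart. The dimension bound provides a
  nonzero vector in the kernel of \<open>b\<close>.\<close>

locale ab_point =
  fixes A :: "real^'n^'n" and b :: "real^'n" and J :: "real set"
  assumes sym: "transpose A = A" and pos: "y \<noteq> 0 \<Longrightarrow> y \<bullet> (A *v y) > 0"
    and J: "open J" and b_nz: "b \<noteq> 0" and card: "CARD('n) \<ge> 2"
begin

lemma swap: "x \<bullet> (A *v y) = y \<bullet> (A *v x)"
  using dot_lmul_matrix[of x A y] sym by (simp add: transpose_matrix_vector[symmetric] inner_commute
      del: transpose_matrix_vector)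

text \<open>The vector \<open>b\<^sup>i\<close>: \<open>\<beta>\<close> is the
  \<open>A\<close>-inner product with \<open>e\<close>, whose squared \<open>A\<close>-length is
  \<open>b\<^sup>2\<close>.\<close>

definition e :: "real^'n" where "e = matrix_inv A *v b"

lemma A_e: "A *v e = b"
proof -
  have "\<forall>x. A *v x = 0 \<longrightarrow> x = 0"
    using pos by (metis inner_zero_right less_irrefl)
  then have "invertible A"
    by (metis invertible_left_inverse matrix_left_invertible_ker)
  then have "A ** matrix_inv A = mat 1"
    unfolding invertible_def matrix_inv_def by (rule someI_ex[THEN conjunct1])
  then show ?thesis
    by (simp add: e_def matrix_vector_mul_assoc)
qed

lemma norm_sq: "ab_norm_sq A b = b \<bullet> e" "ab_norm_sq A b > 0"
proof -
  show "ab_norm_sq A b = b \<bullet> e"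
    by (simp add: ab_norm_sq_eq e_def inner_commute)
  moreover have "e \<noteq> 0"
    using A_e b_nz by auto
  ultimately show "ab_norm_sq A b > 0"
    using pos[of e] by (simp add: A_e inner_commute)
qed

lemma alpha_pos: "y \<noteq> 0 \<Longrightarrow> ab_alpha A y > 0"
  using pos by (simp add: ab_alpha_eq)

lemma alpha_sq: "(ab_alpha A y)\<^sup>2 = y \<bullet> (A *v y)"
  using pos[of y] by (cases "y = 0") (auto simp: ab_alpha_eq)

lemma A_linear: "A *v (x + y) = A *v x + A *v y" "A *v (x - y) = A *v x - A *v y"
  "A *v (r *\<^sub>R x) = r *\<^sub>R (A *v x)"
  by (simp_all add: matrix_vector_right_distrib matrix_vector_mult_diff_distrib matrix_vector_mult_scaleR)

section \<open>Derivatives of \<alpha> and s\<close>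

lemma has_derivative_A: "((*v) A has_derivative (*v) A) (at y)"
  by (simp add: bounded_linear_imp_has_derivative)

lemma has_derivative_quadratic:
  "((\<lambda>y. y \<bullet> (A *v y)) has_derivative (\<lambda>h. 2 * (h \<bullet> (A *v y)))) (at y)"
proof -
  have "((\<lambda>y. y \<bullet> (A *v y)) has_derivative (\<lambda>h. y \<bullet> (A *v h) + h \<bullet> (A *v y))) (at y)"
    by (intro has_derivative_inner has_derivative_ident has_derivative_A)
  then show ?thesis
    by (simp add: swap[of y])
qed

lemma has_derivative_alpha:
  assumes "y \<noteq> 0"
  shows "(ab_alpha A has_derivative (\<lambda>h. h \<bullet> (A *v y) / ab_alpha A y)) (at y)"
proof -
  have "((\<lambda>y. sqrt (y \<bullet> (A *v y))) has_derivative
      (\<lambda>h. 2 * (h \<bullet> (A *v y)) * (inverse (sqrt (y \<bullet> (A *v y))) / 2))) (at y)"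
    using has_derivative_real_sqrt[OF pos[OF assms] has_derivative_quadratic]
    by (simp add: field_simps)
  then show ?thesis
    by (simp add: ab_alpha_eq[abs_def] field_simps)
qed

text \<open>The gradient of \<open>s\<close> is \<open>m / \<alpha>\<close>, because the gradient of
  \<open>\<alpha>\<close> is \<open>A y / \<alpha>\<close>.\<close>

lemma has_derivative_s:
  assumes "y \<noteq> 0"
  shows "(ab_s A b has_derivative
     (\<lambda>h. (h \<bullet> (b - (ab_s A b y / ab_alpha A y) *\<^sub>R (A *v y))) / ab_alpha A y)) (at y)"
proof -
  note p = alpha_pos[OF assms]
  have "((\<lambda>y. (b \<bullet> y) / ab_alpha A y) has_derivative
     (\<lambda>h. ((b \<bullet> h) * ab_alpha A y - (b \<bullet> y) * (h \<bullet> (A *v y) / ab_alpha A y))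
         / (ab_alpha A y * ab_alpha A y))) (at y)"
    using p by (intro has_derivative_divide' has_derivative_alpha assms derivative_intros) auto
  then have "((\<lambda>y. (b \<bullet> y) / ab_alpha A y) has_derivative
     (\<lambda>h. (h \<bullet> (b - (ab_s A b y / ab_alpha A y) *\<^sub>R (A *v y))) / ab_alpha A y)) (at y)"
    by (rule has_derivative_eq_rhs)
      (use p in \<open>simp add: fun_eq_iff ab_s_def ab_beta_eq inner_diff_right inner_commute[of b]
        diff_divide_distrib\<close>)
  then show ?thesis
    unfolding ab_s_def[abs_def] ab_beta_eq .
qed

text \<open>Lets formulas valid only on \<open>ab_D J A b\<close> be differentiated in the full
  space.\<close>

lemma open_D: "open (ab_D J A b)"
proof -
  have "continuous_on (- {0}) (ab_s A b)"
    by (rule continuous_at_imp_continuous_on) (auto intro: has_derivative_continuous[OF has_derivative_s])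
  then have "open (- {0} \<inter> ab_s A b -` J)"
    using J by (intro continuous_open_preimage) auto
  moreover have "- {0} \<inter> ab_s A b -` J = ab_D J A b"
    by (auto simp: ab_D_def)
  ultimately show ?thesis by simp
qed

section \<open>Homogeneity, and the values of s at a point\<close>

lemma alpha_scale: "r > 0 \<Longrightarrow> ab_alpha A (r *\<^sub>R y) = r * ab_alpha A y"
  by (simp add: ab_alpha_eq A_linear real_sqrt_mult)

lemma s_scale: "r > 0 \<Longrightarrow> ab_s A b (r *\<^sub>R y) = ab_s A b y"
  by (simp add: ab_s_def alpha_scale ab_beta_eq)

lemma ab_m_eq:
  assumes "y \<noteq> 0"
  shows "ab_m A b y = A *v (e - (ab_s A b y / ab_alpha A y) *\<^sub>R y)"
  by (simp add: ab_m_def vec_eq_iff partial_eq[OF has_derivative_alpha[OF assms]] A_linear A_e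
      inner_commute[of "axis _ _"] inner_axis)

text \<open>The squared norm \<open>a\<^sup>i\<^sup>j m\<^sub>i m\<^sub>j\<close> equals \<open>b\<^sup>2 - s\<^sup>2\<close>.\<close>

lemma s_bound:
  assumes "y \<noteq> 0"
  shows "(ab_s A b y)\<^sup>2 \<le> ab_norm_sq A b"
    and "ab_m A b y \<noteq> 0 \<longleftrightarrow> (ab_s A b y)\<^sup>2 < ab_norm_sq A b"
proof -
  let ?s = "ab_s A b y" and ?a = "ab_alpha A y"
  \<comment> \<open>\<open>v\<close> is \<open>m\<close> with its index raised, so
    \<open>v \<bullet> (A *v v)\<close> is the squared norm of \<open>m\<close>. Nonnegativity gives
    the bound, definiteness the case of equality.\<close>
  define v where "v = e - (?s / ?a) *\<^sub>R y"
  have p: "?a > 0" using alpha_pos assms .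
  have beta: "b \<bullet> y = ?s * ?a"
    using p by (simp add: ab_s_def ab_beta_eq)
  have "v \<bullet> (A *v v) = b \<bullet> e - 2 * (?s / ?a) * (b \<bullet> y) + (?s / ?a)\<^sup>2 * (y \<bullet> (A *v y))"
    by (simp add: v_def A_linear A_e inner_diff_left inner_diff_right swap[of e y] inner_commute[of _ b]
        power2_eq_square algebra_simps)
  also have "\<dots> = ab_norm_sq A b - ?s\<^sup>2"
    unfolding beta alpha_sq[symmetric] norm_sq using p by (simp add: field_simps power2_eq_square)
  finally have v: "v \<bullet> (A *v v) = ab_norm_sq A b - ?s\<^sup>2" .
  show "?s\<^sup>2 \<le> ab_norm_sq A b"
    using v pos[of v] by (cases "v = 0") auto
  have "ab_m A b y = A *v v"
    by (simp add: ab_m_eq[OF assms] v_def)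
  then show "ab_m A b y \<noteq> 0 \<longleftrightarrow> ?s\<^sup>2 < ab_norm_sq A b"
    using v pos[of v] by (cases "v = 0") auto
qed

text \<open>Take \<open>w\<close> with \<open>b \<bullet> w = 0\<close>, which makes it
  \<open>A\<close>-orthogonal to \<open>e\<close>. Then \<open>p\<close> is forced by
  \<open>\<beta> = s\<close> and \<open>q\<^sup>2\<close> by \<open>\<alpha> = 1\<close>;
  \<open>q\<close> is real since \<open>s\<^sup>2 < b\<^sup>2\<close>. One \<open>w\<close> serves
  all \<open>s\<close>, so constants built from it do not depend on \<open>s\<close>.\<close>

lemma exists_vectors_with_s:
  obtains w where "w \<bullet> (A *v w) > 0"
    "\<And>s. s\<^sup>2 < ab_norm_sq A b \<Longrightarrow> \<exists>p q. p = s / ab_norm_sq A b \<and>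
        q\<^sup>2 = (1 - s\<^sup>2 / ab_norm_sq A b) / (w \<bullet> (A *v w)) \<and>
        (\<forall>y\<in>{p *\<^sub>R e + q *\<^sub>R w, p *\<^sub>R e - q *\<^sub>R w}. y \<noteq> 0 \<and> ab_alpha A y = 1 \<and> ab_s A b y = s)"
proof -
  obtain w where w: "w \<noteq> 0" "b \<bullet> w = 0"
    using orthogonal_to_vector_exists[of b] card by (auto simp: orthogonal_def)
  define W where "W = w \<bullet> (A *v w)"
  have W: "W > 0" using pos[OF w(1)] by (simp add: W_def)
  let ?B = "ab_norm_sq A b"
  have "\<exists>p q. p = s / ?B \<and> q\<^sup>2 = (1 - s\<^sup>2 / ?B) / W \<and>
        (\<forall>y\<in>{p *\<^sub>R e + q *\<^sub>R w, p *\<^sub>R e - q *\<^sub>R w}. y \<noteq> 0 \<and> ab_alpha A y = 1 \<and> ab_s A b y = s)"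
    if s: "s\<^sup>2 < ?B" for s
  proof -
    define q where "q = sqrt ((1 - s\<^sup>2 / ?B) / W)"
    have q: "q\<^sup>2 = (1 - s\<^sup>2 / ?B) / W"
      using s norm_sq(2) W by (simp add: q_def)
    have *: "y \<noteq> 0 \<and> ab_alpha A y = 1 \<and> ab_s A b y = s"
      if y: "y = (s / ?B) *\<^sub>R e + r *\<^sub>R w" and r: "r\<^sup>2 = q\<^sup>2" for y r
    proof -
      have "y \<bullet> (A *v y) = (s / ?B)\<^sup>2 * (b \<bullet> e) + r\<^sup>2 * W"
        using w(2) by (simp add: y A_linear A_e inner_add_left inner_add_right swap[of e w] W_def
            inner_commute[of _ b] power2_eq_square algebra_simps)
      also have "\<dots> = 1"
        unfolding r q norm_sq(1)[symmetric] using norm_sq(2) W by (simp add: power2_eq_square)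
      finally have 1: "y \<bullet> (A *v y) = 1" .
      moreover have "b \<bullet> y = s"
        using w(2) norm_sq by (simp add: y inner_add_right)
      ultimately show ?thesis
        by (auto simp: ab_s_def ab_beta_eq ab_alpha_eq)
    qed
    show ?thesis
      using *[of _ q] *[of _ "- q"] q by (intro exI[of _ "s / ?B"] exI[of _ q]) auto
  qed
  then show ?thesis using that[of w] W by (auto simp: W_def)
qed

lemma s_values_point: "ab_s A b ` ab_Dstar J A b = {s \<in> J. s\<^sup>2 < ab_norm_sq A b}"
proof (intro equalityI subsetI)
  fix s assume "s \<in> {s \<in> J. s\<^sup>2 < ab_norm_sq A b}"
  then obtain y where "y \<noteq> 0" "ab_s A b y = s" "s \<in> J" "s\<^sup>2 < ab_norm_sq A b"
    using exists_vectors_with_s by (metis (no_types, lifting) insertI1 mem_Collect_eq)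
  then show "s \<in> ab_s A b ` ab_Dstar J A b"
    using s_bound(2)[of y] by (auto simp: ab_Dstar_def ab_D_def)
qed (use s_bound(2) in \<open>auto simp: ab_Dstar_def ab_D_def\<close>)

section \<open>The square of F, its gradient and its Hessian\<close>

lemma has_derivative_F_sq:
  assumes "y \<noteq> 0" and \<psi>: "(\<psi> has_field_derivative \<psi>1 (ab_s A b y)) (at (ab_s A b y))"
  shows "((\<lambda>y. (ab_alpha A y)\<^sup>2 * \<psi> (ab_s A b y)) has_derivative
    (\<lambda>h. h \<bullet> ((2 * \<psi> (ab_s A b y)) *\<^sub>R (A *v y)
       + \<psi>1 (ab_s A b y) *\<^sub>R (ab_alpha A y *\<^sub>R b - ab_s A b y *\<^sub>R (A *v y))))) (at y)"
proof -
  let ?s = "ab_s A b y" and ?a = "ab_alpha A y"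
  have p: "?a > 0" using alpha_pos assms(1) .
  have "((\<lambda>y. \<psi> (ab_s A b y)) has_derivative
     (\<lambda>h. \<psi>1 ?s * ((h \<bullet> (b - (?s / ?a) *\<^sub>R (A *v y))) / ?a))) (at y)"
    using has_derivative_compose[OF has_derivative_s[OF assms(1)] \<psi>[unfolded has_field_derivative_def]] .
  from has_derivative_mult[OF has_derivative_quadratic this]
  have "((\<lambda>y. (ab_alpha A y)\<^sup>2 * \<psi> (ab_s A b y)) has_derivative
    (\<lambda>h. ?a\<^sup>2 * (\<psi>1 ?s * ((h \<bullet> (b - (?s / ?a) *\<^sub>R (A *v y))) / ?a))
       + 2 * (h \<bullet> (A *v y)) * \<psi> ?s)) (at y)"
    by (simp add: alpha_sq)
  \<comment> \<open>One factor \<open>\<alpha>\<close> of \<open>\<alpha>\<^sup>2\<close> cancels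
    the denominator in the gradient of \<open>s\<close>.\<close>
  moreover have "?a\<^sup>2 * (k * ((u - ?s / ?a * v) / ?a)) = k * (?a * u - ?s * v)" for k u v
    using p by (simp add: field_simps power2_eq_square)
  then have "?a\<^sup>2 * (\<psi>1 ?s * ((h \<bullet> (b - (?s / ?a) *\<^sub>R (A *v y))) / ?a)) + 2 * (h \<bullet> (A *v y)) * \<psi> ?s
      = h \<bullet> ((2 * \<psi> ?s) *\<^sub>R (A *v y) + \<psi>1 ?s *\<^sub>R (?a *\<^sub>R b - ?s *\<^sub>R (A *v y)))" for h
    by (simp only: inner_add_right inner_diff_right inner_scaleR_right) simp
  ultimately show ?thesis by simp
qed

lemma F_sq: "(ab_F \<phi> A b y)\<^sup>2 = (ab_alpha A y)\<^sup>2 * (\<phi> (ab_s A b y))\<^sup>2"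
  by (simp add: ab_F_def power_mult_distrib)

lemma D_nz: "y \<in> ab_D J A b \<Longrightarrow> y \<noteq> 0" "y \<in> ab_D J A b \<Longrightarrow> ab_s A b y \<in> J"
  by (auto simp: ab_D_def)

lemma alpha_s: "ab_s A b y * ab_alpha A y = b \<bullet> y"
  using alpha_pos[of y] by (cases "y = 0") (auto simp: ab_s_def ab_beta_eq)

text \<open>Euler's theorem, applied to \<open>F\<^sup>2\<close> and to its gradient \<open>G\<close>.\<close>

lemma fundamental_tensor_quadratic:
  assumes \<phi>: "\<And>s. s \<in> J \<Longrightarrow> (\<phi> has_field_derivative \<phi>1 s) (at s)"
      "\<And>s. s \<in> J \<Longrightarrow> (\<phi>1 has_field_derivative \<phi>2 s) (at s)"
    and y: "y \<in> ab_D J A b"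
  shows "y \<bullet> (fundamental_tensor (ab_F \<phi> A b) y *v y) = (ab_F \<phi> A b y)\<^sup>2"
proof -
  define \<psi> where "\<psi> = (\<lambda>s. (\<phi> s)\<^sup>2)"
  define \<psi>1 where "\<psi>1 = (\<lambda>s. 2 * \<phi> s * \<phi>1 s)"
  define \<psi>2 where "\<psi>2 = (\<lambda>s. 2 * (\<phi>1 s * \<phi>1 s + \<phi> s * \<phi>2 s))"
  have \<psi>: "(\<psi> has_field_derivative \<psi>1 s) (at s)" "(\<psi>1 has_field_derivative \<psi>2 s) (at s)"
    if "s \<in> J" for s
    unfolding \<psi>_def \<psi>1_def \<psi>2_def using \<phi>[OF that]
    by (auto intro!: derivative_eq_intros simp: algebra_simps)
  define G where "G = (\<lambda>y. (2 * \<psi> (ab_s A b y)) *\<^sub>R (A *v y)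
       + \<psi>1 (ab_s A b y) *\<^sub>R (ab_alpha A y *\<^sub>R b - ab_s A b y *\<^sub>R (A *v y)))"
  have F: "((\<lambda>y. (ab_F \<phi> A b y)\<^sup>2) has_derivative (\<lambda>h. h \<bullet> G z)) (at z)" if "z \<in> ab_D J A b" for z
    using has_derivative_F_sq[OF D_nz(1)[OF that], of \<psi> \<psi>1] \<psi>(1)[OF D_nz(2)[OF that]]
    by (simp add: F_sq \<psi>_def G_def)
  note nz = D_nz[OF y]
  note ds = has_derivative_s[OF nz(1)]
  note d\<psi> = has_derivative_compose[OF ds \<psi>(1)[OF nz(2), unfolded has_field_derivative_def]]
    has_derivative_compose[OF ds \<psi>(2)[OF nz(2), unfolded has_field_derivative_def]]
  \<comment> \<open>Differentiability of \<open>G\<close> is enough: the only value of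
    \<open>H\<close> required is \<open>H y\<close>, and homogeneity determines it.\<close>
  have "\<exists>H. (G has_derivative H) (at y)"
    unfolding G_def
    by (rule exI, rule has_derivative_add[OF
          has_derivative_scaleR[OF has_derivative_mult_right[OF d\<psi>(1)] has_derivative_A]
          has_derivative_scaleR[OF d\<psi>(2) has_derivative_diff[OF
            has_derivative_scaleR[OF has_derivative_alpha[OF nz(1)] has_derivative_const]
            has_derivative_scaleR[OF ds has_derivative_A]]]])
  then obtain H where H: "(G has_derivative H) (at y)" ..
  have G_scale: "G (r *\<^sub>R y) = r *\<^sub>R G y" if "r > 0" for r
    by (simp add: G_def that alpha_scale s_scale A_linear algebra_simps)
  \<comment> \<open>The curve \<open>G (r *\<^sub>R y)\<close> is differentiated at
    \<open>r = 1\<close> twice, by the chain rule and by homogeneity of degree one.\<close>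
  have "H y = G y"
  proof -
    have "((\<lambda>r. G (r *\<^sub>R y)) has_derivative (\<lambda>t. H (t *\<^sub>R y))) (at 1)"
      by (rule has_derivative_compose[where g = G]) (use H in \<open>auto intro!: derivative_eq_intros\<close>)
    then have "((\<lambda>r. r *\<^sub>R G y) has_derivative (\<lambda>t. H (t *\<^sub>R y))) (at 1)"
      by (rule has_derivative_transform_within_open[of _ _ _ _ "{0<..}"]) (auto simp: G_scale)
    moreover have "((\<lambda>r. r *\<^sub>R G y) has_derivative (\<lambda>t. t *\<^sub>R G y)) (at 1)"
      by (auto intro!: derivative_eq_intros)
    ultimately have "(\<lambda>t. H (t *\<^sub>R y)) = (\<lambda>t. t *\<^sub>R G y)"
      by (rule has_derivative_unique)
    then show ?thesis by (metis scaleR_one)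
  qed
  \<comment> \<open>The \<open>\<psi>1\<close> part is orthogonal to \<open>y\<close>, as
    \<open>\<alpha> (b \<bullet> y) = s \<alpha>\<^sup>2\<close>.\<close>
  moreover have "y \<bullet> G y = 2 * (ab_F \<phi> A b y)\<^sup>2"
    by (simp add: G_def ab_F_def \<psi>_def inner_add_right inner_diff_right alpha_sq[symmetric]
        inner_commute[of y b] alpha_s[symmetric] power2_eq_square)
  ultimately show ?thesis
    by (simp add: fundamental_tensor_eq[OF open_D y F H] scaleR_matrix_vector_assoc[symmetric]
        inner_commute[of y "y v* _"] dot_lmul_matrix matrix_works has_derivative_linear[OF H])
qed

lemma quadratic_if_riemannian:
  assumes "\<And>s. s \<in> J \<Longrightarrow> (\<phi> has_field_derivative \<phi>1 s) (at s)"
      "\<And>s. s \<in> J \<Longrightarrow> (\<phi>1 has_field_derivative \<phi>2 s) (at s)"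
    and "fundamental_tensor (ab_F \<phi> A b) constant_on ab_D J A b"
  obtains k1 k2 where "\<And>s. s \<in> J \<Longrightarrow> s\<^sup>2 < ab_norm_sq A b \<Longrightarrow> (\<phi> s)\<^sup>2 = k1 * s\<^sup>2 + k2"
proof -
  obtain g where g: "\<And>y. y \<in> ab_D J A b \<Longrightarrow> fundamental_tensor (ab_F \<phi> A b) y = g"
    using assms(3) by (auto simp: constant_on_def)
  let ?B = "ab_norm_sq A b"
  obtain w where w: "w \<bullet> (A *v w) > 0"
    "\<And>s. s\<^sup>2 < ?B \<Longrightarrow> \<exists>p q. p = s / ?B \<and>
        q\<^sup>2 = (1 - s\<^sup>2 / ?B) / (w \<bullet> (A *v w)) \<and>
        (\<forall>y\<in>{p *\<^sub>R e + q *\<^sub>R w, p *\<^sub>R e - q *\<^sub>R w}. y \<noteq> 0 \<and> ab_alpha A y = 1 \<and> ab_s A b y = s)"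
    using exists_vectors_with_s by blast
  let ?W = "w \<bullet> (A *v w)"
  \<comment> \<open>The constants come from inserting \<open>p\<^sup>2\<close> and
    \<open>q\<^sup>2\<close>, both affine in \<open>s\<^sup>2\<close>, into
    \<open>p\<^sup>2 g(e, e) + q\<^sup>2 g(w, w)\<close>.\<close>
  have "(\<phi> s)\<^sup>2 = ((e \<bullet> (g *v e)) / ?B\<^sup>2 - (w \<bullet> (g *v w)) / (?B * ?W)) * s\<^sup>2 + (w \<bullet> (g *v w)) / ?W"
    if s: "s \<in> J" "s\<^sup>2 < ?B" for s
  proof -
    obtain p q where p: "p = s / ?B" and q: "q\<^sup>2 = (1 - s\<^sup>2 / ?B) / ?W"
      and y: "\<And>y. y \<in> {p *\<^sub>R e + q *\<^sub>R w, p *\<^sub>R e - q *\<^sub>R w} \<Longrightarrow>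
        y \<noteq> 0 \<and> ab_alpha A y = 1 \<and> ab_s A b y = s"
      using w(2)[OF s(2)] by blast
    have Q: "y \<bullet> (g *v y) = (\<phi> s)\<^sup>2" if "y \<in> {p *\<^sub>R e + q *\<^sub>R w, p *\<^sub>R e - q *\<^sub>R w}" for y
    proof -
      have "y \<in> ab_D J A b" using y[OF that] s(1) by (simp add: ab_D_def)
      then show ?thesis
        using fundamental_tensor_quadratic[OF assms(1,2)] g y[OF that] by (simp add: F_sq)
    qed
    \<comment> \<open>Adding the two instances of \<open>Q\<close> cancels the mixed terms in
      \<open>e\<close> and \<open>w\<close>.\<close>
    have "(\<phi> s)\<^sup>2 = p\<^sup>2 * (e \<bullet> (g *v e)) + q\<^sup>2 * (w \<bullet> (g *v w))"
      using Q[of "p *\<^sub>R e + q *\<^sub>R w"] Q[of "p *\<^sub>R e - q *\<^sub>R w"]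
      by (simp add: matrix_vector_right_distrib matrix_vector_mult_diff_distrib
          matrix_vector_mult_scaleR inner_add_left inner_add_right inner_diff_left inner_diff_right
          power2_eq_square algebra_simps)
    then show ?thesis
      unfolding p q using w(1) norm_sq(2) by (simp add: field_simps power2_eq_square)
  qed
  then show ?thesis using that by blast
qed

text \<open>On all of \<open>ab_D J A b\<close> the square of \<open>F\<close> is
  \<open>k1 \<beta>\<^sup>2 + k2 \<alpha>\<^sup>2\<close>. Its gradient is linear in
  \<open>y\<close>, hence its own derivative at every point, so the Hessian is constant.\<close>

lemma riemannian_if_quadratic:
  assumes cont: "continuous_on J \<phi>"
    and \<phi>: "\<And>s. s \<in> J \<Longrightarrow> s\<^sup>2 < ab_norm_sq A b \<Longrightarrow> (\<phi> s)\<^sup>2 = k1 * s\<^sup>2 + k2"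
  shows "fundamental_tensor (ab_F \<phi> A b) constant_on ab_D J A b"
proof -
  text \<open>Points of \<open>D\<close> outside \<open>D\<^sup>*\<close> have \<open>s\<^sup>2 = b\<^sup>2\<close> and are reached by continuity.\<close>
  have \<phi>': "(\<phi> s)\<^sup>2 = k1 * s\<^sup>2 + k2" if s: "s \<in> J" "s\<^sup>2 \<le> ab_norm_sq A b" for s
  proof (rule ccontr)
    assume ne: "\<not> ?thesis"
    with \<phi>[OF s(1)] s(2) have s2: "s\<^sup>2 = ab_norm_sq A b" by fastforce
    \<comment> \<open>\<open>h r\<close> is the defect of the quadratic formula at
      \<open>r * s\<close>. For \<open>r < 1\<close> close to 1 this argument stays in the open set
      \<open>J\<close> and has square below \<open>s\<^sup>2 = b\<^sup>2\<close>, so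
      \<open>h\<close> vanishes there.\<close>
    define h where "h = (\<lambda>r. (\<phi> (r * s))\<^sup>2 - k1 * (r * s)\<^sup>2 - k2)"
    have "isCont \<phi> (1 * s)"
      using cont J s(1) by (simp add: continuous_on_eq_continuous_at)
    then have "isCont h 1"
      unfolding h_def using isCont_o2[of 1 "\<lambda>r. r * s" \<phi>] by (intro continuous_intros) auto
    then have lim: "(h \<longlongrightarrow> h 1) (at_left 1)"
      by (simp add: isCont_def filterlim_at_split)
    have "((\<lambda>r. r * s) \<longlongrightarrow> 1 * s) (at_left 1)"
      by (intro tendsto_intros)
    then have "\<forall>\<^sub>F r in at_left 1. r * s \<in> J"
      using topological_tendstoD[OF _ J] s(1) by simp
    moreover have "\<forall>\<^sub>F r in at_left (1::real). r \<in> {0<..<1}"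
      by (rule eventually_at_leftI[of 0]) auto
    ultimately have "\<forall>\<^sub>F r in at_left 1. h r = 0"
    proof eventually_elim
      case (elim r)
      have "r\<^sup>2 * s\<^sup>2 < 1 * s\<^sup>2"
        using elim(2) s2 norm_sq(2) by (intro mult_strict_right_mono) (auto simp: power_less_one_iff)
      then show ?case
        using \<phi>[OF elim(1)] s2 by (simp add: h_def power_mult_distrib)
    qed
    then have "(h \<longlongrightarrow> 0) (at_left 1)"
      by (rule tendsto_eventually)
    then have "h 1 = 0"
      using lim tendsto_unique trivial_limit_at_left_real by blast
    then show False using ne by (simp add: h_def)
  qed
  have F: "(ab_F \<phi> A b y)\<^sup>2 = k1 * (b \<bullet> y)\<^sup>2 + k2 * (y \<bullet> (A *v y))" if "y \<in> ab_D J A b" for y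
    using \<phi>'[OF D_nz(2)[OF that] s_bound(1)[OF D_nz(1)[OF that]]]
    by (simp add: F_sq alpha_s[symmetric] alpha_sq[symmetric] power_mult_distrib algebra_simps)
  define G where "G = (\<lambda>y. (2 * k1 * (b \<bullet> y)) *\<^sub>R b + (2 * k2) *\<^sub>R (A *v y))"
  have G: "((\<lambda>y. (ab_F \<phi> A b y)\<^sup>2) has_derivative (\<lambda>h. h \<bullet> G z)) (at z)" if "z \<in> ab_D J A b" for z
  proof (rule has_derivative_transform_within_open[OF _ open_D that])
    show "((\<lambda>y. k1 * (b \<bullet> y)\<^sup>2 + k2 * (y \<bullet> (A *v y))) has_derivative (\<lambda>h. h \<bullet> G z)) (at z)"
      by (rule has_derivative_eq_rhs, (rule derivative_intros has_derivative_quadratic)+)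
        (simp add: G_def inner_add_right inner_commute fun_eq_iff)
  qed (simp add: F)
  have H: "(G has_derivative G) (at z)" for z
    unfolding G_def by (intro derivative_intros has_derivative_A)
  show ?thesis
    unfolding constant_on_def using fundamental_tensor_eq[OF open_D _ G H] by blast
qed

end

section \<open>From single points to the whole manifold\<close>

theorem theorem2p7:
  fixes M :: "'m topology"
    and \<A> :: "('m, 'n::finite) chart set"
    and a :: "('m, 'n) chart \<Rightarrow> real^'n \<Rightarrow> real^'n^'n"
    and b :: "('m, 'n) chart \<Rightarrow> real^'n \<Rightarrow> real^'n"
    and \<phi> :: "real \<Rightarrow> real" and b0 :: real and J :: "real set"
  assumes "smooth_manifold M \<A>"
    and "CARD('n) \<ge> 3"
    and "alpha_beta_metric \<A> a b \<phi> b0 J"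
    and "nowhere_zero \<A> b"
  shows "((\<forall>s\<in>s_values \<A> a b J. rho1 \<phi> s = 0) \<longleftrightarrow> (\<forall>s\<in>s_values \<A> a b J. rho2 \<phi> s = 0)) \<and>
    ((\<forall>s\<in>s_values \<A> a b J. rho2 \<phi> s = 0) \<longleftrightarrow> F_is_riemannian \<A> a b \<phi> J) \<and>
    (F_is_riemannian \<A> a b \<phi> J \<longleftrightarrow>
       (\<exists>k1 k2. \<forall>s\<in>s_values \<A> a b J. \<phi> s = sqrt (k1 * s\<^sup>2 + k2)))"
proof -
  have Jcases: "J = {-b0<..<b0} \<or> J = {0<..<b0}" and \<phi>_pos: "\<And>t. t \<in> J \<Longrightarrow> \<phi> t > 0"
    and smooth: "smooth_on J \<phi>"
    using assms(3) by (simp_all add: alpha_beta_metric_def)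
  have J: "open J" "is_interval J"
    using Jcases is_interval_oo by auto
  \<comment> \<open>Order 3 because the equation \<open>rho1 \<phi> s = 0\<close>, of second order,
    is differentiated once more.\<close>
  have "Ck_on 3 J \<phi>"
    using smooth by (simp add: smooth_on_def)
  then have Ck: "Ck_on (Suc (Suc (Suc 0))) J \<phi>"
    by (simp only: numeral_3_eq_3)
  note Ck' = Ck_on_Suc_deriv(1)[OF J(1) Ck]
  note D = Ck_on_Suc_deriv(2)[OF J(1) Ck] Ck_on_Suc_deriv(2)[OF J(1) Ck']
    Ck_on_Suc_deriv(2)[OF J(1) Ck_on_Suc_deriv(1)[OF J(1) Ck']]
  let ?B = "\<lambda>c x. ab_norm_sq (a c x) (b c x)"
  let ?S = "s_values \<A> a b J"
  have point: "ab_point (a c x) (b c x) J" if "c \<in> \<A>" "x \<in> chart_image c" for c x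
    using assms(2-4) that J(1)
    by unfold_locales
      (auto simp: alpha_beta_metric_def riemannian_metric_def nowhere_zero_def simp del: transpose_matrix_vector)
  have S_eq: "?S = (\<Union>c\<in>\<A>. \<Union>x\<in>chart_image c. {s \<in> J. s\<^sup>2 < ?B c x})"
    unfolding s_values_def using ab_point.s_values_point[OF point] by simp
  have open_point: "open {s \<in> J. s\<^sup>2 < B}" for B
  proof -
    have "open {s::real. s\<^sup>2 < B}"
      by (intro open_Collect_less continuous_intros)
    then have "open (J \<inter> {s. s\<^sup>2 < B})"
      using J(1) by (rule open_Int[rotated])
    moreover have "J \<inter> {s. s\<^sup>2 < B} = {s \<in> J. s\<^sup>2 < B}"
      by blast
    ultimately show ?thesis by simp
  qed
  have S: "open ?S" "?S \<subseteq> J"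
    unfolding S_eq by (auto intro!: open_point)
  have "is_interval ?S"
    unfolding is_interval_1
  proof (intro ballI allI impI)
    fix s t u assume st: "s \<in> ?S" "t \<in> ?S" and u: "s \<le> u \<and> u \<le> t"
    have "u \<in> J"
      using J(2) st S(2) u unfolding is_interval_1 by blast
    \<comment> \<open>Hence \<open>u\<close> is attained at the same point as \<open>s\<close> or as
      \<open>t\<close>, so the union over all points is an interval whether or not the manifold is
      connected.\<close>
    moreover have "u\<^sup>2 \<le> s\<^sup>2 \<or> u\<^sup>2 \<le> t\<^sup>2"
      using u unfolding abs_le_square_iff[symmetric] by linarith
    ultimately show "u \<in> ?S"
      using st unfolding S_eq by (auto intro: le_less_trans)
  qed
  then have S_conn: "connected ?S"
    by (simp add: is_interval_connected)
  have D_S: "\<And>s. s \<in> ?S \<Longrightarrow> (\<phi> has_field_derivative deriv \<phi> s) (at s)"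
      "\<And>s. s \<in> ?S \<Longrightarrow> (deriv \<phi> has_field_derivative deriv (deriv \<phi>) s) (at s)"
      "\<And>s. s \<in> ?S \<Longrightarrow> (deriv (deriv \<phi>) has_field_derivative deriv (deriv (deriv \<phi>)) s) (at s)"
    using D S(2) by blast+
  have ab: "\<forall>s\<in>?S. rho2 \<phi> s = 0" if "\<forall>s\<in>?S. rho1 \<phi> s = 0"
    using that by (simp add: rho2_eq_rho1)
  have ba: "\<forall>s\<in>?S. rho1 \<phi> s = 0" if "\<forall>s\<in>?S. rho2 \<phi> s = 0"
  proof
    fix s assume s: "s \<in> ?S"
    show "rho1 \<phi> s = 0"
      using that rho1_0_if_rho2_0[OF S(1) s] D_S[OF s, THEN DERIV_isCont] by blast
  qed
  have ad: "\<exists>k1 k2. \<forall>s\<in>?S. \<phi> s = sqrt (k1 * s\<^sup>2 + k2)" if 0: "\<forall>s\<in>?S. rho1 \<phi> s = 0"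
  proof -
    have "\<exists>k1 k2. \<forall>s\<in>?S. (\<phi> s)\<^sup>2 = k1 * s\<^sup>2 + k2"
      using D_S 0 by (intro quadratic_if_rho1_0[OF S(1) S_conn]) auto
    then obtain k1 k2 where "\<And>s. s \<in> ?S \<Longrightarrow> (\<phi> s)\<^sup>2 = k1 * s\<^sup>2 + k2"
      by blast
    then have "\<phi> s = sqrt (k1 * s\<^sup>2 + k2)" if "s \<in> ?S" for s
      using that \<phi>_pos[of s] S(2) by (metis less_imp_le real_sqrt_unique subsetD)
    then show ?thesis by blast
  qed
  have dc: "F_is_riemannian \<A> a b \<phi> J" if "\<exists>k1 k2. \<forall>s\<in>?S. \<phi> s = sqrt (k1 * s\<^sup>2 + k2)"
  proof -
    from that obtain k1 k2 where k: "\<And>s. s \<in> ?S \<Longrightarrow> \<phi> s = sqrt (k1 * s\<^sup>2 + k2)" by blast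
    \<comment> \<open>\<open>sqrt\<close> is negative on negative arguments, so
      \<open>\<phi> s > 0\<close> makes the radicand positive and squaring removes the root.\<close>
    have sq: "(\<phi> s)\<^sup>2 = k1 * s\<^sup>2 + k2" if "s \<in> ?S" for s
      using k[OF that] \<phi>_pos[of s] that S(2) by auto
    have cont: "continuous_on J \<phi>"
      by (rule continuous_at_imp_continuous_on) (auto intro: DERIV_isCont[OF D(1)])
    show ?thesis
      unfolding F_is_riemannian_def
    proof (intro ballI)
      fix c x assume cx: "c \<in> \<A>" "x \<in> chart_image c"
      have "(\<phi> s)\<^sup>2 = k1 * s\<^sup>2 + k2" if "s \<in> J" "s\<^sup>2 < ?B c x" for s
        using sq that cx unfolding S_eq by blast
      then show "fundamental_tensor (ab_F \<phi> (a c x) (b c x)) constant_on ab_D J (a c x) (b c x)"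
        using ab_point.riemannian_if_quadratic[OF point[OF cx] cont] by blast
    qed
  qed
  have ca: "\<forall>s\<in>?S. rho1 \<phi> s = 0" if F: "F_is_riemannian \<A> a b \<phi> J"
  proof
    fix s assume "s \<in> ?S"
    then obtain c x where cx: "c \<in> \<A>" "x \<in> chart_image c" and s: "s \<in> {s \<in> J. s\<^sup>2 < ?B c x}"
      unfolding S_eq by blast
    \<comment> \<open>These constants belong to the point with coordinates \<open>x\<close> in the
      chart \<open>c\<close>; the conclusion about \<open>rho1\<close> no longer contains
      them.\<close>
    obtain k1 k2 where k: "\<And>s. s \<in> J \<Longrightarrow> s\<^sup>2 < ?B c x \<Longrightarrow> (\<phi> s)\<^sup>2 = k1 * s\<^sup>2 + k2"
      using ab_point.quadratic_if_riemannian[OF point[OF cx] D(1,2)] F cx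
      unfolding F_is_riemannian_def by blast
    show "rho1 \<phi> s = 0"
      by (rule rho1_0_if_quadratic[OF open_point s, of \<phi> k1 k2]) (use k D(1,2) in auto)
  qed
  show ?thesis
    using ab ba ad dc ca by blast
qed

end
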